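(* (i) If $(S,\lambda)$ is a ditopological left unosemigroup and $X\subset S$ is a subsemigroup with $\lambda(X)\subset X$, then $(X,\lambda|X)$ is a ditopological left unosemigroup. (ii) If $(S,\rho)$ is a ditopological right unosemigroup and $X\subset S$ is a subsemigroup with $\rho(X)\subset X$, then $(X,\rho|X)$ is a ditopological right unosemigroup. (iii) If $(S,\lambda,\rho)$ is a ditopological unosemigroup and $X\subset S$ is a subsemigroup with $\lambda(X)\cup\rho(X)\subset X$, then $(X,\lambda|X,\rho|X)$ is a ditopological unosemigroup. Here $X$ carries the subspace topology.
   Context: A topological semigroup is a non-empty topological space $S$ endowed with a continuous associative binary operation $\cdot:S\times S\to S$. A left (resp. right) unit operation on $S$ is a map $\lambda:S\to S$ with $\lambda(x)\cdot x=x$ (resp. a map $\rho:S\to S$ with $x\cdot\rho(x)=x$) for all $x\in S$. Subsemigroups are non-empty. For $A,B\subset S$ put $A\leftthreetimes B=\{x\in S: ax\in B \text{ for some } a\in A\}$ and $B\rightthreetimes A=\{x\in S: xa\in B\text{ for some }a\in A\}$. A continuous left unit operation $\lambda$ is dicontinuous if for every $x\in S$ and every neighborhood $O_x\subset S$ of $x$ there are a neighborhood $U_x\subset S$ of $x$ and a neighborhood $W_{\lambda(x)}\subset\lambda(S)$ of $\lambda(x)$ in the subspace $\lambda(S)$ such that $(W_{\lambda(x)}\leftthreetimes U_x)\cap\lambda^{-1}(W_{\lambda(x)})\subset O_x$. A continuous right unit operation $\rho$ is dicontinuous if for every $x\in S$ and every neighborhood $O_x\subset S$ of $x$ there are a neighborhood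 $U_x\subset S$ of $x$ and a neighborhood $W_{\rho(x)}\subset\rho(S)$ of $\rho(x)$ in the subspace $\rho(S)$ such that $(U_x\rightthreetimes W_{\rho(x)})\cap\rho^{-1}(W_{\rho(x)})\subset O_x$. A ditopological left unosemigroup $(S,\lambda)$ (right unosemigroup $(S,\rho)$, unosemigroup $(S,\lambda,\rho)$) is a topological semigroup $S$ endowed with a dicontinuous left unit operation $\lambda$ (a dicontinuous right unit operation $\rho$, both). *)

theory Defs
  imports "HOL-Analysis.Abstract_Topology" "HOL-Analysis.Product_Topology"
begin

text \<open>
  A semigroup is given by a topology \<open>T\<close>, whose carrier is \<open>topspace T\<close>, and a total function
  \<open>m\<close> of which only the values on the carrier matter; the same applies to unit operations.
\<close>

definition topological_semigroup :: "'a topology \<Rightarrow> ('a \<Rightarrow> 'a \<Rightarrow> 'a) \<Rightarrow> bool" where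
  "topological_semigroup T m \<longleftrightarrow>
     topspace T \<noteq> {} \<and>
     continuous_map (prod_topology T T) T (\<lambda>(x, y). m x y) \<and>
     (\<forall>x\<in>topspace T. \<forall>y\<in>topspace T. \<forall>z\<in>topspace T. m (m x y) z = m x (m y z))"

definition subsemigroup :: "'a set \<Rightarrow> 'a topology \<Rightarrow> ('a \<Rightarrow> 'a \<Rightarrow> 'a) \<Rightarrow> bool" where
  "subsemigroup X T m \<longleftrightarrow>
     X \<noteq> {} \<and> X \<subseteq> topspace T \<and> (\<forall>x\<in>X. \<forall>y\<in>X. m x y \<in> X)"

definition left_unit_operation :: "'a set \<Rightarrow> ('a \<Rightarrow> 'a \<Rightarrow> 'a) \<Rightarrow> ('a \<Rightarrow> 'a) \<Rightarrow> bool" where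
  "left_unit_operation S m l \<longleftrightarrow> (\<forall>x\<in>S. l x \<in> S \<and> m (l x) x = x)"

definition right_unit_operation :: "'a set \<Rightarrow> ('a \<Rightarrow> 'a \<Rightarrow> 'a) \<Rightarrow> ('a \<Rightarrow> 'a) \<Rightarrow> bool" where
  "right_unit_operation S m r \<longleftrightarrow> (\<forall>x\<in>S. r x \<in> S \<and> m x (r x) = x)"

text \<open>Neighbourhoods need not be open.\<close>

definition neighbourhood_in :: "'a topology \<Rightarrow> 'a \<Rightarrow> 'a set \<Rightarrow> bool" where
  "neighbourhood_in T x N \<longleftrightarrow> N \<subseteq> topspace T \<and> (\<exists>V. openin T V \<and> x \<in> V \<and> V \<subseteq> N)"

text \<open>\<open>left_quot S m A B\<close> is $A \leftthreetimes B$ and \<open>right_quot S m B A\<close> is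
  $B \rightthreetimes A$, both computed in the semigroup with carrier \<open>S\<close>.\<close>

definition left_quot :: "'a set \<Rightarrow> ('a \<Rightarrow> 'a \<Rightarrow> 'a) \<Rightarrow> 'a set \<Rightarrow> 'a set \<Rightarrow> 'a set" where
  "left_quot S m A B = {x \<in> S. \<exists>a\<in>A. m a x \<in> B}"

definition right_quot :: "'a set \<Rightarrow> ('a \<Rightarrow> 'a \<Rightarrow> 'a) \<Rightarrow> 'a set \<Rightarrow> 'a set \<Rightarrow> 'a set" where
  "right_quot S m B A = {x \<in> S. \<exists>a\<in>A. m x a \<in> B}"

definition dicontinuous_left :: "'a topology \<Rightarrow> ('a \<Rightarrow> 'a \<Rightarrow> 'a) \<Rightarrow> ('a \<Rightarrow> 'a) \<Rightarrow> bool" where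
  "dicontinuous_left T m l \<longleftrightarrow>
     continuous_map T T l \<and>
     (\<forall>x\<in>topspace T. \<forall>N. neighbourhood_in T x N \<longrightarrow>
        (\<exists>U W. neighbourhood_in T x U \<and>
               neighbourhood_in (subtopology T (l ` topspace T)) (l x) W \<and>
               left_quot (topspace T) m W U \<inter> {y \<in> topspace T. l y \<in> W} \<subseteq> N))"

definition dicontinuous_right :: "'a topology \<Rightarrow> ('a \<Rightarrow> 'a \<Rightarrow> 'a) \<Rightarrow> ('a \<Rightarrow> 'a) \<Rightarrow> bool" where
  "dicontinuous_right T m r \<longleftrightarrow>
     continuous_map T T r \<and>
     (\<forall>x\<in>topspace T. \<forall>N. neighbourhood_in T x N \<longrightarrow>
        (\<exists>U W. neighbourhood_in T x U \<and>
               neighbourhood_in (subtopology T (r ` topspace T)) (r x) W \<and>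
               right_quot (topspace T) m U W \<inter> {y \<in> topspace T. r y \<in> W} \<subseteq> N))"

definition ditopological_left_unosemigroup ::
    "'a topology \<Rightarrow> ('a \<Rightarrow> 'a \<Rightarrow> 'a) \<Rightarrow> ('a \<Rightarrow> 'a) \<Rightarrow> bool" where
  "ditopological_left_unosemigroup T m l \<longleftrightarrow>
     topological_semigroup T m \<and> left_unit_operation (topspace T) m l \<and> dicontinuous_left T m l"

definition ditopological_right_unosemigroup ::
    "'a topology \<Rightarrow> ('a \<Rightarrow> 'a \<Rightarrow> 'a) \<Rightarrow> ('a \<Rightarrow> 'a) \<Rightarrow> bool" where
  "ditopological_right_unosemigroup T m r \<longleftrightarrow>
     topological_semigroup T m \<and> right_unit_operation (topspace T) m r \<and> dicontinuous_right T m r"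

definition ditopological_unosemigroup ::
    "'a topology \<Rightarrow> ('a \<Rightarrow> 'a \<Rightarrow> 'a) \<Rightarrow> ('a \<Rightarrow> 'a) \<Rightarrow> ('a \<Rightarrow> 'a) \<Rightarrow> bool" where
  "ditopological_unosemigroup T m l r \<longleftrightarrow>
     topological_semigroup T m \<and>
     left_unit_operation (topspace T) m l \<and> dicontinuous_left T m l \<and>
     right_unit_operation (topspace T) m r \<and> dicontinuous_right T m r"

end

theory Submission
  imports Defs
begin

text \<open>Dicontinuity passes to traces on X. A neighbourhood of x in X contains the trace of a
  neighbourhood M of x in the whole space; dicontinuity there yields U and W for M. Their traces on
  X and on the image of X under \<open>l\<close> are neighbourhoods in the required subspaces, and
  intersecting only shrinks the quotient, so the resulting set lies in M and in X. This is
  \<open>dicontinuous_left_subtopology\<close>. The right-handed case is the left-handed one for the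
  opposite multiplication, while algebraic laws and continuity restrict directly.\<close>

lemma neighbourhood_in_subtopology_Int:
  assumes "neighbourhood_in T x N" "x \<in> Y"
  shows "neighbourhood_in (subtopology T Y) x (N \<inter> Y)"
proof -
  obtain V where V: "openin T V" "x \<in> V" "V \<subseteq> N"
    using assms(1) by (auto simp: neighbourhood_in_def)
  have "openin (subtopology T Y) (V \<inter> Y)"
    using V(1) by (auto simp: openin_subtopology)
  moreover have "N \<inter> Y \<subseteq> topspace (subtopology T Y)"
    using assms(1) by (auto simp: neighbourhood_in_def)
  ultimately show ?thesis
    using V assms(2) unfolding neighbourhood_in_def by blast
qed

text \<open>Since only an inclusion is asked for, the ambient open set whose trace lies in
  \<open>N\<close> can itself serve as \<open>M\<close>.\<close>

lemma neighbourhood_in_subtopologyE: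
  assumes "neighbourhood_in (subtopology T Y) x N"
  obtains M where "neighbourhood_in T x M" "M \<inter> Y \<subseteq> N"
proof -
  obtain V where "openin T V" "x \<in> V" "V \<inter> Y \<subseteq> N"
    using assms unfolding neighbourhood_in_def openin_subtopology by blast
  then show ?thesis
    using that[of V] openin_subset unfolding neighbourhood_in_def by blast
qed

lemma topological_semigroup_subtopology:
  assumes "topological_semigroup T m" "subsemigroup X T m"
  shows "topological_semigroup (subtopology T X) m"
proof -
  have X: "topspace (subtopology T X) = X" "X \<subseteq> topspace T"
    using assms(2) by (auto simp: subsemigroup_def)
  have "continuous_map (subtopology (prod_topology T T) (X \<times> X)) T (\<lambda>(x, y). m x y)"
    using assms(1) by (auto simp: topological_semigroup_def intro: continuous_map_from_subtopology)
  \<comment> \<open>The product of the subspaces is the subspace of the product on X times X, and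
    closure of X under \<open>m\<close> lets the codomain shrink to X.\<close>
  then have "continuous_map (prod_topology (subtopology T X) (subtopology T X))
      (subtopology T X) (\<lambda>(x, y). m x y)"
    using assms(2) X
    by (auto simp: continuous_map_in_subtopology prod_topology_subtopology subtopology_subtopology
        subsemigroup_def Times_Int_Times)
  then show ?thesis
    using assms X by (simp add: topological_semigroup_def subsemigroup_def subset_iff)
qed

lemma left_unit_operation_restrict:
  assumes "left_unit_operation S m l" "X \<subseteq> S" "l ` X \<subseteq> X"
  shows "left_unit_operation X m (restrict l X)"
  using assms by (auto simp: left_unit_operation_def)

text \<open>The operation \<open>m\<close> is arbitrary here, so that the result also applies to the
  flipped multiplication.\<close>

lemma dicontinuous_left_subtopology:
  assumes l: "dicontinuous_left T m l" and X: "X \<subseteq> topspace T" and lX: "l ` X \<subseteq> X"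
  shows "dicontinuous_left (subtopology T X) m (restrict l X)"
proof -
  have tX: "topspace (subtopology T X) = X"
    using X by auto
  have "continuous_map (subtopology T X) (subtopology T X) l"
    using l lX by (auto simp: dicontinuous_left_def continuous_map_in_subtopology
        intro: continuous_map_from_subtopology)
  then have cont: "continuous_map (subtopology T X) (subtopology T X) (restrict l X)"
    by (rule continuous_map_eq) auto
  have "\<exists>U W. neighbourhood_in (subtopology T X) x U \<and>
          neighbourhood_in (subtopology (subtopology T X) (restrict l X ` X)) (restrict l X x) W \<and>
          left_quot X m W U \<inter> {y \<in> X. restrict l X y \<in> W} \<subseteq> N"
    if x: "x \<in> X" and N: "neighbourhood_in (subtopology T X) x N" for x N
  proof -
    obtain M where M: "neighbourhood_in T x M" "M \<inter> X \<subseteq> N"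
      using N by (rule neighbourhood_in_subtopologyE)
    then obtain U W where U: "neighbourhood_in T x U"
      and W: "neighbourhood_in (subtopology T (l ` topspace T)) (l x) W"
      and UW: "left_quot (topspace T) m W U \<inter> {y \<in> topspace T. l y \<in> W} \<subseteq> M"
      using l x X unfolding dicontinuous_left_def by blast
    \<comment> \<open>\<open>W\<close> lives in the image of the whole space, whereas the goal takes
      a subspace of X. Both iterated subspaces are the one on the image of X under \<open>l\<close>,
      because that image lies in X.\<close>
    have "l ` topspace T \<inter> l ` X = X \<inter> l ` X"
      using X lX by blast
    then have W': "neighbourhood_in (subtopology (subtopology T X) (l ` X)) (l x) (W \<inter> l ` X)"
      using neighbourhood_in_subtopology_Int[OF W, of "l ` X"] x
      by (simp add: subtopology_subtopology)
    \<comment> \<open>Any y in the left-hand side has its witness in \<open>W\<close> and its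
      product in \<open>U\<close>, so \<open>UW\<close> puts it in \<open>M\<close>; as y is also in
      X, it lies in \<open>N\<close>.\<close>
    have "left_quot X m (W \<inter> l ` X) (U \<inter> X) \<inter> {y \<in> X. l y \<in> W \<inter> l ` X} \<subseteq> N"
      using UW M(2) X unfolding left_quot_def by blast
    \<comment> \<open>The guard \<open>y \<in> X\<close>, made available by
      \<open>conj_cong\<close>, turns \<open>restrict l X y\<close> into \<open>l y\<close>.\<close>
    then show ?thesis
      using neighbourhood_in_subtopology_Int[OF U x] W' x
      by (intro exI[of _ "U \<inter> X"] exI[of _ "W \<inter> l ` X"]) (auto cong: conj_cong)
  qed
  then show ?thesis
    using cont unfolding dicontinuous_left_def tX by blast
qed

lemma right_unit_operation_iff_left_opposite:
  "right_unit_operation S m r \<longleftrightarrow> left_unit_operation S (\<lambda>x y. m y x) r"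
  by (simp add: right_unit_operation_def left_unit_operation_def)

text \<open>Swapping the arguments of \<open>m\<close> turns the right quotient into the left one;
  the topological conditions do not involve \<open>m\<close>.\<close>

lemma dicontinuous_right_iff_left_opposite:
  "dicontinuous_right T m r \<longleftrightarrow> dicontinuous_left T (\<lambda>x y. m y x) r"
  by (simp add: dicontinuous_right_def dicontinuous_left_def right_quot_def left_quot_def)

theorem proposition4:
  fixes T :: "'a topology" and m :: "'a \<Rightarrow> 'a \<Rightarrow> 'a" and l r :: "'a \<Rightarrow> 'a" and X :: "'a set"
  assumes "subsemigroup X T m"
  shows "(ditopological_left_unosemigroup T m l \<and> l ` X \<subseteq> X \<longrightarrow>
            ditopological_left_unosemigroup (subtopology T X) m (restrict l X)) \<and>
         (ditopological_right_unosemigroup T m r \<and> r ` X \<subseteq> X \<longrightarrow>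
            ditopological_right_unosemigroup (subtopology T X) m (restrict r X)) \<and>
         (ditopological_unosemigroup T m l r \<and> l ` X \<union> r ` X \<subseteq> X \<longrightarrow>
            ditopological_unosemigroup (subtopology T X) m (restrict l X) (restrict r X))"
proof -
  have X: "X \<subseteq> topspace T" "topspace (subtopology T X) = X"
    using assms by (auto simp: subsemigroup_def)
  show ?thesis
    \<comment> \<open>Only the unit and dicontinuity conditions are rewritten to the opposite
      multiplication; \<open>topological_semigroup\<close> keeps \<open>m\<close>, so one
      restriction lemma per condition settles all three claims.\<close>
    unfolding ditopological_left_unosemigroup_def ditopological_right_unosemigroup_def
      ditopological_unosemigroup_def right_unit_operation_iff_left_opposite
      dicontinuous_right_iff_left_opposite X(2) Un_subset_iff
    by (intro conjI impI; elim conjE;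
        intro topological_semigroup_subtopology[OF _ assms] left_unit_operation_restrict[OF _ X(1)]
          dicontinuous_left_subtopology[OF _ X(1)]; assumption)
qed

end
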